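(* Let $x=P(x)$ be a minPPS in simple normal form with greatest fixed point $g^*<\mathbf{1}$, and let $\epsilon>0$. Let $\sigma$ be the deterministic policy output by Algorithm minPPS-$\epsilon$-policy1 (described in the context), let $\tau$ be a deterministic policy with $g^*_\tau<\mathbf{1}$, and let $\upsilon$ be the randomized policy which, at each form-M variable, follows the choice of $\tau$ with probability $2^{-28|P|-4}\epsilon$ and the choice of $\sigma$ with the remaining probability $1-2^{-28|P|-4}\epsilon$. Then $\|g^*-g^*_\upsilon\|_\infty\le\epsilon$, i.e., $\upsilon$ is $\epsilon$-optimal.
   Context: A minPPS in SNF is a system $x_i=P_i(x)$, $i=1..n$, each $P_i$ of form L ($a_{i,0}+\sum_ja_{i,j}x_j$, rational $a_{i,j}\ge0$, $\sum_{j\ge0}a_{i,j}\le1$), Q ($x_jx_k$), or M ($\min\{x_j,x_k\}$); $|P|$ is its bit encoding size; $g^*$ its greatest fixed point in $[0,1]^n$. A (randomized) policy assigns to each form-M variable a probability distribution over its two choices; $P_\sigma$ is the PPS obtained by replacing each $\min\{x_j,x_k\}$ by the corresponding convex combination of $x_j,x_k$; $g^*_\sigma$ is the greatest fixed point of $x=P_\sigma(x)$. Algorithm minPPS-$\epsilon$-policy1: (1) compute $y$ with $\mathbf{0}\le y\le g^*$ and $\|g^*-y\|_\infty\le2^{-14|P|-3}\epsilon$; (2) let $k:=0$ and let $\sigma_0$ be a deterministic policy with $P_{\sigma_0}(y)=P(y)$ (each form-M variable chooses a variable of minimum value in $y$); (3) compute $F_{\sigma_k}$, the set of variables that, in the dependency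 graph of $x=P_{\sigma_k}(x)$ (edge $x_i\to x_j$ iff $x_j$ occurs in $(P_{\sigma_k})_i$), are or can reach a variable $x_i$ which has form Q or satisfies $P_i(\mathbf{1})<1$ or $P_i(\mathbf{0})>0$, and let $D_{\sigma_k}$ be its complement; (4) if $D_{\sigma_k}\ne\emptyset$, pick a form-M variable $x_i\in D_{\sigma_k}$ having a choice $x_j\in F_{\sigma_k}$, different from its current choice, with $|y_i-y_j|\le2^{-14|P|-2}\epsilon$, let $\sigma_{k+1}$ choose $x_j$ at $x_i$ and agree with $\sigma_k$ elsewhere, set $k:=k+1$ and go to (3); (5) if $D_{\sigma_k}=\emptyset$, output $\sigma_k$. *)

theory Defs
  imports "HOL-Probability.Probability" "HOL-Library.Log_Nat"
begin

datatype ('n, 'c) form =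
    FormL 'c "'n \<Rightarrow> 'c"
  | FormQ 'n 'n
  | FormM 'n 'n

fun eval_form :: "('n::finite, real) form \<Rightarrow> real ^ 'n \<Rightarrow> real" where
  "eval_form (FormL a0 a) x = a0 + (\<Sum>j\<in>UNIV. a j * x $ j)"
| "eval_form (FormQ j k) x = x $ j * x $ k"
| "eval_form (FormM j k) x = min (x $ j) (x $ k)"

fun occurs :: "'n \<Rightarrow> ('n, real) form \<Rightarrow> bool" where
  "occurs l (FormL a0 a) \<longleftrightarrow> a l \<noteq> 0"
| "occurs l (FormQ j k) \<longleftrightarrow> l = j \<or> l = k"
| "occurs l (FormM j k) \<longleftrightarrow> l = j \<or> l = k"

fun is_formQ :: "('n, 'c) form \<Rightarrow> bool" where
  "is_formQ (FormQ j k) \<longleftrightarrow> True"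
| "is_formQ _ \<longleftrightarrow> False"

text \<open>A system \<open>x = P(x)\<close> maps each variable to its right-hand side. Input systems have
  rational coefficients; systems with real coefficients arise by fixing a randomized policy.\<close>

type_synonym ('n, 'c) system = "'n \<Rightarrow> ('n, 'c) form"

definition minPPS_SNF :: "('n::finite, rat) system \<Rightarrow> bool" where
  "minPPS_SNF P \<longleftrightarrow>
     (\<forall>i a0 a. P i = FormL a0 a \<longrightarrow>
        a0 \<ge> 0 \<and> (\<forall>j. a j \<ge> 0) \<and> a0 + (\<Sum>j\<in>UNIV. a j) \<le> 1)"

definition real_system :: "('n, rat) system \<Rightarrow> ('n, real) system" where
  "real_system P = (\<lambda>i. map_form real_of_rat (P i))"

definition eval_system :: "('n::finite, real) system \<Rightarrow> real ^ 'n \<Rightarrow> real ^ 'n" where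
  "eval_system S x = (\<chi> i. eval_form (S i) x)"

text \<open>The order on vectors is componentwise, so \<open>{0..1}\<close> is the unit cube.\<close>

definition gfix :: "('n::finite, real) system \<Rightarrow> real ^ 'n" where
  "gfix S = (GREATEST x. x \<in> {0..1} \<and> eval_system S x = x)"

text \<open>Bit encoding size: two bits per equation tell the three forms apart. With \<open>n\<close> variables,
  an index from \<open>0..n\<close> takes \<open>floorlog 2 n\<close> bits. A form-L right-hand side lists its nonzero
  coefficients, each preceded by its index (\<open>0\<close> for the constant term) and written as a reduced
  fraction with numerator and denominator in binary.\<close>

definition rat_size :: "rat \<Rightarrow> nat" where
  "rat_size q = floorlog 2 (nat \<bar>fst (quotient_of q)\<bar>) + floorlog 2 (nat (snd (quotient_of q)))"

definition index_size :: "'n::finite itself \<Rightarrow> nat" where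
  "index_size _ = floorlog 2 CARD('n)"

fun form_size :: "('n::finite, rat) form \<Rightarrow> nat" where
  "form_size (FormL a0 a) = 2 +
     (if a0 = 0 then 0 else index_size TYPE('n) + rat_size a0) +
     (\<Sum>j | a j \<noteq> 0. index_size TYPE('n) + rat_size (a j))"
| "form_size (FormQ j k) = 2 + 2 * index_size TYPE('n)"
| "form_size (FormM j k) = 2 + 2 * index_size TYPE('n)"

definition system_size :: "('n::finite, rat) system \<Rightarrow> nat" where
  "system_size P = (\<Sum>i\<in>UNIV. form_size (P i))"

text \<open>At a variable with right-hand side \<open>FormM j k\<close>, the choice \<open>True\<close> stands for \<open>j\<close> and
  \<open>False\<close> for \<open>k\<close>. Values of a policy at variables of other forms are irrelevant.\<close>

type_synonym 'n policy = "'n \<Rightarrow> bool pmf"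
type_synonym 'n det_policy = "'n \<Rightarrow> bool"

definition pure_policy :: "'n det_policy \<Rightarrow> 'n policy" where
  "pure_policy \<sigma> = (\<lambda>i. return_pmf (\<sigma> i))"

definition choice :: "'n \<Rightarrow> 'n \<Rightarrow> bool \<Rightarrow> 'n" where
  "choice j k b = (if b then j else k)"

definition policy_system :: "('n, rat) system \<Rightarrow> 'n policy \<Rightarrow> ('n, real) system" where
  "policy_system P \<rho> = (\<lambda>i. case P i of
       FormM j k \<Rightarrow>
         FormL 0 (\<lambda>l. pmf (\<rho> i) True * of_bool (l = j) + pmf (\<rho> i) False * of_bool (l = k))
     | f \<Rightarrow> map_form real_of_rat f)"

definition dep_graph :: "('n, real) system \<Rightarrow> ('n \<times> 'n) set" where
  "dep_graph S = {(i, j). occurs j (S i)}"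

definition F_set :: "('n::finite, real) system \<Rightarrow> 'n set" where
  "F_set S = {i. \<exists>l. (i, l) \<in> (dep_graph S)\<^sup>* \<and>
     (is_formQ (S l) \<or> eval_system S 1 $ l < 1 \<or> eval_system S 0 $ l > 0)}"

definition D_set :: "('n::finite, real) system \<Rightarrow> 'n set" where
  "D_set S = - F_set S"

text \<open>The policies \<open>\<sigma>\<^sub>k\<close> that some run of the algorithm can visit, given the vector \<open>y\<close>
  computed in its first step; all nondeterministic choices are left open.\<close>

inductive policy1_visits ::
    "('n::finite, rat) system \<Rightarrow> real \<Rightarrow> real ^ 'n \<Rightarrow> 'n det_policy \<Rightarrow> bool"
  for P \<epsilon> y where
  init: "eval_system (policy_system P (pure_policy \<sigma>)) y = eval_system (real_system P) y
    \<Longrightarrow> policy1_visits P \<epsilon> y \<sigma>"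
| switch: "\<lbrakk>policy1_visits P \<epsilon> y \<sigma>;
     i \<in> D_set (policy_system P (pure_policy \<sigma>));
     P i = FormM j k;
     b \<noteq> \<sigma> i;
     choice j k b \<in> F_set (policy_system P (pure_policy \<sigma>));
     \<bar>y $ i - y $ choice j k b\<bar> \<le> 2 powr (- 14 * real (system_size P) - 2) * \<epsilon>\<rbrakk>
    \<Longrightarrow> policy1_visits P \<epsilon> y (\<sigma>(i := b))"

definition policy1_output :: "('n::finite, rat) system \<Rightarrow> real \<Rightarrow> 'n det_policy \<Rightarrow> bool" where
  "policy1_output P \<epsilon> \<sigma> \<longleftrightarrow>
     (\<exists>y. 0 \<le> y \<and> y \<le> gfix (real_system P) \<and>
        infnorm (gfix (real_system P) - y) \<le> 2 powr (- 14 * real (system_size P) - 3) * \<epsilon> \<and>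
        policy1_visits P \<epsilon> y \<sigma> \<and>
        D_set (policy_system P (pure_policy \<sigma>)) = {})"

end

theory Submission
  imports Defs
begin

text \<open>
  Write \<open>g\<close> for the greatest fixed point of the minPPS, \<open>S\<close> for the system of the mixed policy
  and \<open>\<rho> = 2\<^sup>-\<^sup>N\<close> with \<open>N\<close> the encoding size. Call a variable a leak if its right-hand side is less
  than \<open>1\<close> at the all-ones vector. If \<open>g < 1\<close>, every variable reaches a leak, since a closed set
  without leaks has value \<open>1\<close>; multiplying coefficients along a simple path gives \<open>1 - g \<ge> \<rho>\<close>.

  The vector \<open>y\<close> is a fixed point of \<open>S\<close> up to an error \<open>\<eta>\<close> of order \<open>\<rho>\<^sup>1\<^sup>4 \<epsilon>\<close>. Because every
  variable reaches, under \<open>\<sigma>\<close>, a product, a leak or a constant term, one can write down a vector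
  \<open>s\<close> of size \<open>O(\<eta> / \<rho>\<^sup>4)\<close> such that \<open>h = y + s\<close> satisfies \<open>h < 1\<close> and \<open>S(h) \<le> h\<close>.

  The mixing weight of \<open>\<tau>\<close> is needed only qualitatively: it makes the greatest fixed point of \<open>S\<close>
  smaller than \<open>1\<close>, and then it lies below every pre-fixed point \<open>h < 1\<close>. Hence it exceeds
  \<open>g \<ge> y\<close> by at most \<open>s \<le> \<epsilon>\<close>.
\<close>

definition substochastic :: "('n::finite, real) system \<Rightarrow> bool" where
  "substochastic S \<longleftrightarrow> (\<forall>i a0 a. S i = FormL a0 a \<longrightarrow>
     0 \<le> a0 \<and> (\<forall>j. 0 \<le> a j) \<and> a0 + (\<Sum>j\<in>UNIV. a j) \<le> 1)"

lemma eval_system_nth [simp]: "eval_system S x $ i = eval_form (S i) x"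
  by (simp add: eval_system_def)

lemma eval_form_mono:
  assumes "substochastic S" "\<And>i. 0 \<le> x $ i" "\<And>i. x $ i \<le> y $ i"
  shows "eval_form (S i) x \<le> eval_form (S i) y"
proof (cases "S i")
  case (FormL a0 a)
  then have "\<And>j. 0 \<le> a j" using assms(1) by (auto simp: substochastic_def)
  then show ?thesis using FormL assms by (auto intro!: sum_mono mult_left_mono)
next
  case (FormQ j k)
  have "x $ k \<ge> 0" "x $ j \<ge> 0" "x $ j \<le> y $ j" "x $ k \<le> y $ k" using assms by auto
  then show ?thesis using FormQ by (auto intro!: mult_mono)
next
  case (FormM j k)
  have "x $ j \<le> y $ j" "x $ k \<le> y $ k" using assms by auto
  then show ?thesis using FormM by auto
qed

lemma eval_form_one_le:
  assumes "substochastic S"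
  shows "eval_form (S i) 1 \<le> 1"
  using assms by (cases "S i") (auto simp: substochastic_def)

lemma eval_form_zero_ge:
  assumes "substochastic S"
  shows "0 \<le> eval_form (S i) 0"
  using assms by (cases "S i") (auto simp: substochastic_def)

lemma eval_system_unit_cube:
  assumes "substochastic S" "x \<in> {0..1}"
  shows "eval_system S x \<in> {0..1}"
proof -
  have x: "\<And>i. 0 \<le> x $ i" "\<And>i. x $ i \<le> 1"
    using assms(2) by (auto simp: less_eq_vec_def)
  have "eval_form (S i) 0 \<le> eval_form (S i) x" "eval_form (S i) x \<le> eval_form (S i) 1" for i
    using x by (auto intro!: eval_form_mono assms)
  then have "0 \<le> eval_form (S i) x" "eval_form (S i) x \<le> 1" for i
    using eval_form_one_le[OF assms(1), of i] eval_form_zero_ge[OF assms(1), of i] order_trans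
    by metis+
  then show ?thesis by (auto simp: less_eq_vec_def)
qed

lemma gfix_greatest:
  fixes S :: "('n::finite, real) system"
  assumes S: "substochastic S"
  shows "gfix S \<in> {0..1}" "eval_system S (gfix S) = gfix S"
    "\<And>x. x \<in> {0..1} \<Longrightarrow> x \<le> eval_system S x \<Longrightarrow> x \<le> gfix S"
proof -
  define A where "A = {x :: real ^ 'n. x \<in> {0..1} \<and> x \<le> eval_system S x}"
  define g :: "real ^ 'n" where "g = (\<chi> i. Sup ((\<lambda>x. x $ i) ` A))"
  have zA: "0 \<in> A"
    using eval_form_zero_ge[OF S] by (auto simp: A_def less_eq_vec_def)
  have le1: "x $ i \<le> 1" and ge0: "0 \<le> x $ i" if "x \<in> A" for x i
    using that by (auto simp: A_def less_eq_vec_def)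
  have bdd: "bdd_above ((\<lambda>x. x $ i) ` A)" for i
    using le1 by (auto intro!: bdd_aboveI[of _ 1])
  have ub: "x $ i \<le> g $ i" if "x \<in> A" for x i
    unfolding g_def using that bdd by (auto intro!: cSup_upper)
  have lub: "g $ i \<le> c" if "\<And>x. x \<in> A \<Longrightarrow> x $ i \<le> c" for i c
    unfolding g_def using that zA by (auto intro!: cSup_least)
  have g01: "g \<in> {0..1}"
    using ub[OF zA] lub le1 by (auto simp: less_eq_vec_def)
  have post: "g \<le> eval_system S g"
    unfolding less_eq_vec_def
  proof (intro allI lub)
    fix i x assume x: "x \<in> A"
    then have "x $ i \<le> eval_form (S i) x" by (auto simp: A_def less_eq_vec_def)
    also have "\<dots> \<le> eval_form (S i) g"
      using ge0[OF x] ub[OF x] by (intro eval_form_mono S)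
    finally show "x $ i \<le> eval_system S g $ i" by simp
  qed
  have "eval_system S g \<in> A"
    unfolding A_def
  proof (intro CollectI conjI)
    show "eval_system S g \<in> {0..1}" by (rule eval_system_unit_cube[OF S g01])
    show "eval_system S g \<le> eval_system S (eval_system S g)"
      using post g01 by (auto simp: less_eq_vec_def intro!: eval_form_mono[OF S])
  qed
  then have "eval_system S g \<le> g" using ub unfolding less_eq_vec_def by blast
  with post have fp: "eval_system S g = g" by (rule order.antisym[rotated])
  have "gfix S = g"
    unfolding gfix_def
  proof (rule Greatest_equality)
    show "g \<in> {0..1} \<and> eval_system S g = g" using g01 fp by simp
    show "x \<le> g" if "x \<in> {0..1} \<and> eval_system S x = x" for x
    proof -
      have "x \<in> A" using that by (simp add: A_def)
      then show ?thesis using ub by (simp add: less_eq_vec_def)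
    qed
  qed
  then show "gfix S \<in> {0..1}" "eval_system S (gfix S) = gfix S"
    "\<And>x. x \<in> {0..1} \<Longrightarrow> x \<le> eval_system S x \<Longrightarrow> x \<le> gfix S"
    using g01 fp ub by (auto simp: A_def less_eq_vec_def)
qed

lemma gfix_bounds:
  assumes "substochastic S"
  shows "0 \<le> gfix S $ i" "gfix S $ i \<le> 1" "eval_form (S i) (gfix S) = gfix S $ i"
  using gfix_greatest(1,2)[OF assms] by (auto simp: less_eq_vec_def vec_eq_iff)

lemma gfix_eq_one_on_closed:
  assumes S: "substochastic S"
    and C: "\<And>i j. i \<in> C \<Longrightarrow> occurs j (S i) \<Longrightarrow> j \<in> C"
    and leak: "\<And>i. i \<in> C \<Longrightarrow> eval_form (S i) 1 = 1"
    and i: "i \<in> C"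
  shows "gfix S $ i = 1"
proof -
  let ?g = "gfix S"
  define x where "x = (\<chi> i. if i \<in> C then 1 else ?g $ i)"
  have x01: "x \<in> {0..1}"
    using gfix_bounds[OF S] by (auto simp: x_def less_eq_vec_def)
  have "x $ k \<le> eval_form (S k) x" for k
  proof (cases "k \<in> C")
    case True
    have x1: "x $ l = 1" if "occurs l (S k)" for l using C[OF True that] by (simp add: x_def)
    have "eval_form (S k) x = eval_form (S k) 1"
    proof (cases "S k")
      case (FormL a0 a)
      then have "a l * x $ l = a l" for l using x1[of l] by (cases "a l = 0") auto
      then have "(\<Sum>l\<in>UNIV. a l * x $ l) = sum a UNIV" by (intro sum.cong refl)
      then show ?thesis using FormL by simp
    qed (use x1 in auto)
    then show ?thesis using leak[OF True] True by (simp add: x_def)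
  next
    case False
    have "?g $ k = eval_form (S k) ?g" using gfix_bounds[OF S] by simp
    also have "\<dots> \<le> eval_form (S k) x"
      using gfix_bounds[OF S] by (intro eval_form_mono S) (auto simp: x_def)
    finally show ?thesis using False by (simp add: x_def)
  qed
  then have "x \<le> ?g" using x01 by (intro gfix_greatest S) (auto simp: less_eq_vec_def)
  then have "x $ i \<le> ?g $ i" by (simp add: less_eq_vec_def)
  then show ?thesis using i gfix_bounds(2)[OF S, of i] by (simp add: x_def)
qed

lemma reaches_leak:
  assumes S: "substochastic S" and lt: "\<And>i. gfix S $ i < 1"
  shows "\<exists>l. (i, l) \<in> (dep_graph S)\<^sup>* \<and> eval_form (S l) 1 < 1"
proof (rule ccontr)
  assume neg: "\<not> ?thesis"
  define C where "C = {j. (i, j) \<in> (dep_graph S)\<^sup>*}"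
  have "gfix S $ i = 1"
  proof (rule gfix_eq_one_on_closed[OF S])
    show "i \<in> C" by (simp add: C_def)
    show "k \<in> C" if "j \<in> C" "occurs k (S j)" for j k
      using that by (auto simp: C_def dep_graph_def intro: rtrancl_into_rtrancl)
    show "eval_form (S j) 1 = 1" if "j \<in> C" for j
      using that neg eval_form_one_le[OF S, of j] by (auto simp: C_def not_less)
  qed
  then show False using lt[of i] by simp
qed

lemma reach_induct [consumes 1, case_names empty insert]:
  fixes E :: "('n::finite \<times> 'n) set"
  assumes reach: "\<And>i. \<exists>l\<in>T. (i, l) \<in> E\<^sup>*"
    and "Q {}"
    and step: "\<And>X i. Q X \<Longrightarrow> i \<notin> X \<Longrightarrow> i \<in> T \<or> (\<exists>b\<in>X. (i, b) \<in> E) \<Longrightarrow> Q (insert i X)"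
  shows "Q UNIV"
proof -
  have "\<exists>X. Q X \<and> card X = m" if "m \<le> CARD('n)" for m
    using that
  proof (induction m)
    case 0
    then show ?case using \<open>Q {}\<close> by auto
  next
    case (Suc m)
    then obtain X where X: "Q X" "card X = m" by auto
    have "\<exists>i. i \<notin> X \<and> (i \<in> T \<or> (\<exists>b\<in>X. (i, b) \<in> E))"
    proof (rule ccontr)
      assume neg: "\<nexists>i. i \<notin> X \<and> (i \<in> T \<or> (\<exists>b\<in>X. (i, b) \<in> E))"
      obtain i where "i \<notin> X" using X Suc.prems by (metis Suc_n_not_le_n UNIV_eq_I)
      obtain l where l: "l \<in> T" "(i, l) \<in> E\<^sup>*" using reach by blast
      from l(2) have "l \<notin> X" by (induction) (use \<open>i \<notin> X\<close> neg in blast)+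
      then show False using l neg by blast
    qed
    then obtain i where i: "i \<notin> X" "i \<in> T \<or> (\<exists>b\<in>X. (i, b) \<in> E)" by blast
    show ?case using step[OF X(1) i] X(2) i(1) by (intro exI[of _ "insert i X"]) auto
  qed
  then obtain X where "Q X" "card X = CARD('n)" by blast
  then show ?thesis using card_eq_UNIV_imp_eq_UNIV[of X] by auto
qed

lemma reach_lower_bound:
  fixes c f :: "'n::finite \<Rightarrow> real"
  assumes reach: "\<And>i. \<exists>l\<in>T. (i, l) \<in> E\<^sup>*"
    and c: "\<And>i. 0 \<le> c i" "\<And>i. c i \<le> 1"
    and T: "\<And>i. i \<in> T \<Longrightarrow> c i \<le> f i"
    and E: "\<And>i b. (i, b) \<in> E \<Longrightarrow> c i * f b \<le> f i"
  shows "prod c UNIV \<le> f i"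
proof -
  have "\<forall>i\<in>UNIV. prod c UNIV \<le> f i"
    using reach
  proof (induction rule: reach_induct)
    case (insert X i)
    have p: "0 \<le> prod c X" "prod c X \<le> 1" using c by (auto intro: prod_nonneg prod_le_1)
    have "c i * prod c X \<le> f x" if "x \<in> insert i X" for x
    proof (cases "x \<in> X")
      case True
      have "c i * prod c X \<le> 1 * prod c X" using c p by (intro mult_right_mono)
      then show ?thesis using insert(1) True by force
    next
      case False
      then have [simp]: "x = i" using that by simp
      show ?thesis
      proof (cases "i \<in> T")
        case True
        have "c i * prod c X \<le> c i * 1" using c p by (intro mult_left_mono)
        then show ?thesis using T[OF True] by simp
      next
        case False
        then obtain b where b: "b \<in> X" "(i, b) \<in> E" using insert(3) by blast
        have "c i * prod c X \<le> c i * f b" using insert(1) b c by (intro mult_left_mono) auto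
        then show ?thesis using E[OF b(2)] by simp
      qed
    qed
    then show ?case using insert(2) by simp
  qed simp
  then show ?thesis by simp
qed

lemma reach_potential:
  fixes c :: "'n::finite \<Rightarrow> real"
  assumes reach: "\<And>i. \<exists>l\<in>T. (i, l) \<in> E\<^sup>*"
    and c: "\<And>i. 0 \<le> c i" "\<And>i. c i \<le> 1"
  obtains \<phi> where "\<And>i. prod c UNIV \<le> \<phi> i" "\<And>i. \<phi> i \<le> 1"
    "\<And>i. i \<notin> T \<Longrightarrow> \<exists>b. (i, b) \<in> E \<and> \<phi> i = c i * \<phi> b"
proof -
  have "\<exists>\<phi>. \<forall>i\<in>UNIV. prod c UNIV \<le> \<phi> i \<and> \<phi> i \<le> 1 \<and>
      (i \<notin> T \<longrightarrow> (\<exists>b\<in>UNIV. (i, b) \<in> E \<and> \<phi> i = c i * \<phi> b))"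
    using reach
  proof (induction rule: reach_induct)
    case (insert X i)
    then obtain \<phi> where \<phi>: "\<And>x. x \<in> X \<Longrightarrow> prod c X \<le> \<phi> x \<and> \<phi> x \<le> 1 \<and>
      (x \<notin> T \<longrightarrow> (\<exists>b\<in>X. (x, b) \<in> E \<and> \<phi> x = c x * \<phi> b))" by blast
    have p: "0 \<le> prod c X" "prod c X \<le> 1" using c by (auto intro: prod_nonneg prod_le_1)
    have cp: "c i * prod c X \<le> 1 * prod c X" using c p by (intro mult_right_mono)
    obtain r where r: "c i * prod c X \<le> r" "r \<le> 1"
      "i \<notin> T \<Longrightarrow> \<exists>b\<in>X. (i, b) \<in> E \<and> r = c i * \<phi> b"
    proof (cases "i \<in> T")
      case True
      then show ?thesis using that[of 1] cp p by simp
    next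
      case False
      then obtain b where b: "b \<in> X" "(i, b) \<in> E" using insert(3) by blast
      have "c i * prod c X \<le> c i * \<phi> b" using \<phi> b c by (intro mult_left_mono) auto
      moreover have "c i * \<phi> b \<le> 1"
        using \<phi>[OF b(1)] c p by (intro mult_le_one) auto
      ultimately show ?thesis using that[of "c i * \<phi> b"] b by blast
    qed
    show ?case
    proof (intro exI[of _ "\<phi>(i := r)"] ballI)
      fix x assume x: "x \<in> insert i X"
      have iX: "i \<notin> X" by fact
      show "prod c (insert i X) \<le> (\<phi>(i := r)) x \<and> (\<phi>(i := r)) x \<le> 1 \<and>
        (x \<notin> T \<longrightarrow> (\<exists>b\<in>insert i X. (x, b) \<in> E \<and> (\<phi>(i := r)) x = c x * (\<phi>(i := r)) b))"
      proof (cases "x = i")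
        case True
        then show ?thesis using r iX by auto
      next
        case False
        then have xX: "x \<in> X" using x by simp
        have "prod c (insert i X) \<le> \<phi> x" using \<phi>[OF xX] cp iX by simp
        moreover have "\<exists>b\<in>insert i X. (x, b) \<in> E \<and> \<phi> x = c x * (\<phi>(i := r)) b" if "x \<notin> T"
          using \<phi>[OF xX] that iX by (metis fun_upd_other insertCI)
        ultimately show ?thesis using False \<phi>[OF xX] by auto
      qed
    qed
  qed simp
  then show ?thesis using that by blast
qed

lemma one_minus_fixpoint_ge:
  assumes S: "substochastic S" and x: "\<And>i. 0 \<le> x $ i" "\<And>i. x $ i \<le> 1"
    and fp: "\<And>i. eval_form (S i) x = x $ i"
  shows "1 - eval_form (S i) 1 \<le> 1 - x $ i"
    "S i = FormL a0 a \<Longrightarrow> a j * (1 - x $ j) \<le> 1 - x $ i"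
    "occurs j (S i) \<Longrightarrow> (\<And>a0 a. S i \<noteq> FormL a0 a) \<Longrightarrow> 1 - x $ j \<le> 1 - x $ i"
proof -
  have "eval_form (S i) x \<le> eval_form (S i) 1" using x by (intro eval_form_mono S) auto
  then show "1 - eval_form (S i) 1 \<le> 1 - x $ i" using fp by simp
next
  assume L: "S i = FormL a0 a"
  then have a: "\<And>j. 0 \<le> a j" "a0 + sum a UNIV \<le> 1" using S by (auto simp: substochastic_def)
  have "a j * (1 - x $ j) \<le> (\<Sum>j\<in>UNIV. a j * (1 - x $ j))"
    using a x by (intro member_le_sum) auto
  also have "\<dots> = sum a UNIV - (\<Sum>j\<in>UNIV. a j * x $ j)"
    by (simp add: algebra_simps sum_subtractf)
  also have "\<dots> \<le> 1 - x $ i" using a fp[of i] L by simp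
  finally show "a j * (1 - x $ j) \<le> 1 - x $ i" .
next
  assume o: "occurs j (S i)" and nL: "\<And>a0 a. S i \<noteq> FormL a0 a"
  show "1 - x $ j \<le> 1 - x $ i"
  proof (cases "S i")
    case (FormQ k l)
    have "x $ k * x $ l \<le> x $ k * 1" "x $ k * x $ l \<le> 1 * x $ l"
      using x by (intro mult_left_mono mult_right_mono; simp)+
    then show ?thesis using o FormQ fp[of i] by auto
  qed (use o nL fp[of i] in auto)
qed


text \<open>On the set where \<open>(g - h) / (1 - g)\<close> attains a positive maximum there are neither products
  nor leaks, and the set is closed; so \<open>g = 1\<close> there.\<close>

lemma gfix_le_prefixpoint:
  fixes S :: "('n::finite, real) system"
  assumes S: "substochastic S" and noM: "\<And>i j k. S i \<noteq> FormM j k"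
    and lt: "\<And>i. gfix S $ i < 1"
    and h: "\<And>i. 0 \<le> h $ i" "\<And>i. h $ i < 1"
    and pre: "\<And>i. eval_form (S i) h \<le> h $ i"
  shows "gfix S $ i \<le> h $ i"
proof (rule ccontr)
  assume neg: "\<not> gfix S $ i \<le> h $ i"
  define g where "g = (\<lambda>i. gfix S $ i)"
  define z where "z = (\<lambda>i. 1 - g i)"
  define d where "d = (\<lambda>i. g i - h $ i)"
  define \<kappa> where "\<kappa> = Max (range (\<lambda>i. d i / z i))"
  have z: "0 < z i" for i using lt by (simp add: z_def g_def)
  have g0: "0 \<le> g i" and gfp: "eval_form (S i) (gfix S) = g i" for i
    using gfix_bounds[OF S] by (auto simp: g_def)
  have "d i / z i \<le> \<kappa>" for i unfolding \<kappa>_def by (intro Max_ge) auto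
  then have d_le: "d i \<le> \<kappa> * z i" for i using z[of i] pos_divide_le_eq by blast
  have "0 < d i" using neg by (simp add: d_def g_def)
  then have "0 < \<kappa> * z i" using d_le[of i] by linarith
  then have \<kappa>: "0 < \<kappa>" using z[of i] by (simp add: zero_less_mult_iff)
  define C where "C = {i. d i = \<kappa> * z i}"
  have "\<kappa> \<in> range (\<lambda>i. d i / z i)" unfolding \<kappa>_def by (intro Max_in) auto
  then obtain i0 where "\<kappa> = d i0 / z i0" by blast
  then have i0: "i0 \<in> C" using z[of i0] by (simp add: C_def)
  have row: "eval_form (S i) 1 = 1 \<and> (\<forall>j. occurs j (S i) \<longrightarrow> j \<in> C)" if i: "i \<in> C" for i
  proof (cases "S i")
    case (FormL a0 a)
    then have a: "\<And>j. 0 \<le> a j" "a0 + sum a UNIV \<le> 1" using S by (auto simp: substochastic_def)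
    have "g i = a0 + (\<Sum>j\<in>UNIV. a j * g j)" using gfp[of i] FormL by (simp add: g_def)
    moreover have "a0 + (\<Sum>j\<in>UNIV. a j * h $ j) \<le> h $ i" using pre[of i] FormL by simp
    ultimately have "d i \<le> (\<Sum>j\<in>UNIV. a j * d j)"
      and zi: "z i = 1 - (a0 + sum a UNIV) + (\<Sum>j\<in>UNIV. a j * z j)"
      by (simp_all add: d_def z_def algebra_simps sum_subtractf)
    then have "(\<Sum>j\<in>UNIV. a j * (\<kappa> * z j - d j)) \<le> \<kappa> * (\<Sum>j\<in>UNIV. a j * z j) - d i"
      by (simp add: right_diff_distrib sum_subtractf sum_distrib_left mult.left_commute)
    also have "\<dots> = - (\<kappa> * (1 - (a0 + sum a UNIV)))"
      using i zi by (simp add: C_def algebra_simps)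
    finally have le: "(\<Sum>j\<in>UNIV. a j * (\<kappa> * z j - d j)) + \<kappa> * (1 - (a0 + sum a UNIV)) \<le> 0" by simp
    have t0: "0 \<le> a j * (\<kappa> * z j - d j)" for j using a d_le[of j] by simp
    have s0: "0 \<le> (\<Sum>j\<in>UNIV. a j * (\<kappa> * z j - d j))" using t0 by (intro sum_nonneg)
    have k0: "0 \<le> \<kappa> * (1 - (a0 + sum a UNIV))" using a \<kappa> by simp
    have "(\<Sum>j\<in>UNIV. a j * (\<kappa> * z j - d j)) = 0" "\<kappa> * (1 - (a0 + sum a UNIV)) = 0"
      using le s0 k0 by linarith+
    then have "\<forall>j. a j * (\<kappa> * z j - d j) = 0" "a0 + sum a UNIV = 1"
      using t0 \<kappa> by (auto simp: sum_nonneg_eq_0_iff)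
    then show ?thesis using FormL by (auto simp: C_def)
  next
    case (FormQ j k)
    have gi: "g i = g j * g k" using gfp[of i] FormQ by (simp add: g_def)
    have "h $ j * h $ k \<le> h $ i" using pre[of i] FormQ by simp
    then have "d i \<le> (g j + h $ j) / 2 * d k + (g k + h $ k) / 2 * d j"
      using gi by (simp add: d_def field_simps)
    also have "\<dots> \<le> (g j + h $ j) / 2 * (\<kappa> * z k) + (g k + h $ k) / 2 * (\<kappa> * z j)"
      using g0 h d_le by (intro add_mono mult_left_mono) auto
    also have "\<dots> < (g j + 1) / 2 * (\<kappa> * z k) + (g k + 1) / 2 * (\<kappa> * z j)"
      using h \<kappa> z by (intro add_strict_mono mult_strict_right_mono) auto
    also have "\<dots> = \<kappa> * z i" using gi by (simp add: z_def field_simps)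
    finally show ?thesis using i by (simp add: C_def)
  next
    case (FormM j k)
    then show ?thesis using noM by blast
  qed
  have "gfix S $ i0 = 1" using row i0 by (intro gfix_eq_one_on_closed[OF S, of C]) auto
  then show False using lt[of i0] by simp
qed

text \<open>The witness is \<open>h = y + t v\<close> with \<open>v = C (K w + 1) - \<phi>\<close> and \<open>w = 1 - y\<close>. Linearising at
  \<open>y + w / 4\<close>, the term \<open>K w\<close> gains \<open>K w\<^sub>j w\<^sub>k / 2\<close> at products, the term \<open>1\<close> gains at rows whose
  coefficients sum to at most \<open>1 - \<rho>\<close>, and \<open>- \<phi>\<close> gains at the remaining rows.\<close>

lemma prefixpoint_near:
  fixes S :: "('n::finite, real) system" and y :: "real ^ 'n" and \<phi> :: "'n \<Rightarrow> real"
  assumes S: "substochastic S" and noM: "\<And>i j k. S i \<noteq> FormM j k"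
    and \<rho>: "0 < \<rho>" "\<rho> \<le> 1"
    and y: "\<And>i. 0 \<le> y $ i" "\<And>i. y $ i \<le> 1 - \<rho>"
    and e: "\<And>i. \<bar>eval_form (S i) y - y $ i\<bar> \<le> \<eta>" and \<eta>: "40 * \<eta> \<le> \<rho> ^ 5"
    and \<phi>: "\<And>i. \<rho> \<le> \<phi> i" "\<And>i. \<phi> i \<le> 1"
    and rowL: "\<And>i a0 a. S i = FormL a0 a \<Longrightarrow>
      sum a UNIV \<le> 1 - \<rho> \<or> 2 * \<phi> i \<le> (\<Sum>j\<in>UNIV. a j * \<phi> j)"
  obtains h where "\<And>i. y $ i \<le> h $ i" "\<And>i. h $ i < 1" "\<And>i. eval_form (S i) h \<le> h $ i"
    "\<And>i. h $ i \<le> y $ i + 20 * \<eta> / \<rho> ^ 4"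
proof -
  define w where "w = (\<lambda>i. 1 - y $ i)"
  define C where "C = 2 / \<rho>"
  define K where "K = 4 / \<rho>\<^sup>2"
  define v where "v = (\<lambda>i. C * (K * w i + 1) - \<phi> i)"
  have \<eta>0: "0 \<le> \<eta>" using e[of undefined] by linarith
  have C: "C * \<rho> = 2" "2 \<le> C" and K: "K * \<rho>\<^sup>2 = 4" "0 < K"
    using \<rho> by (auto simp: C_def K_def field_simps)
  have w: "\<rho> \<le> w i" "w i \<le> 1" for i using y[of i] by (auto simp: w_def)
  have "C * K * \<eta> = 8 * \<eta> / \<rho> ^ 3"
    by (simp add: C_def K_def power2_eq_square power3_eq_cube)
  also have "\<dots> \<le> 8 * (\<rho> ^ 5 / 40) / \<rho> ^ 3"
    using \<eta> \<rho> by (intro divide_right_mono) auto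
  also have "\<dots> = \<rho>\<^sup>2 / 5" using \<rho> by (simp add: field_simps power_numeral_reduce)
  also have "\<dots> \<le> \<rho> / 2" using \<rho> by (simp add: power2_eq_square mult_left_le)
  finally have CK: "C * K * \<eta> \<le> \<rho> / 2" .
  have v0: "0 \<le> v i" for i
  proof -
    have "C * 1 \<le> C * (K * w i + 1)" using C K w[of i] \<rho> by (intro mult_left_mono) auto
    then show ?thesis using C \<phi>(2)[of i] unfolding v_def by linarith
  qed
  have v1: "v i \<le> 10 / \<rho> ^ 3" for i
  proof -
    have "1 \<le> 1 / \<rho>\<^sup>2" using \<rho> by (simp add: power_le_one)
    moreover have "K * w i \<le> K" using mult_left_le[of "w i" K] w[of i] K by simp
    moreover have "K + 1 / \<rho>\<^sup>2 = 5 / \<rho>\<^sup>2" by (simp add: K_def flip: add_divide_distrib)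
    ultimately have "K * w i + 1 \<le> 5 / \<rho>\<^sup>2" by linarith
    then have "C * (K * w i + 1) \<le> C * (5 / \<rho>\<^sup>2)" using C by (intro mult_left_mono) auto
    also have "\<dots> = 10 / \<rho> ^ 3" by (simp add: C_def power2_eq_square power3_eq_cube)
    finally show ?thesis using \<phi>(1)[of i] \<rho> by (simp add: v_def)
  qed
  have vL: "\<rho> / 2 \<le> v i - (\<Sum>j\<in>UNIV. a j * v j)" if L: "S i = FormL a0 a" for i a0 a
  proof -
    have a: "\<And>j. 0 \<le> a j" "0 \<le> a0" "a0 + sum a UNIV \<le> 1"
      using S L by (auto simp: substochastic_def)
    have "(\<Sum>j\<in>UNIV. a j * w j) = sum a UNIV - (\<Sum>j\<in>UNIV. a j * y $ j)"
      by (simp add: w_def algebra_simps sum_subtractf)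
    then have "- \<eta> \<le> w i - (\<Sum>j\<in>UNIV. a j * w j)"
      using e[of i] L a by (simp add: w_def)
    then have "C * K * (- \<eta>) \<le> C * K * (w i - (\<Sum>j\<in>UNIV. a j * w j))"
      using C K by (intro mult_left_mono) auto
    then have 1: "- (\<rho> / 2) \<le> C * K * (w i - (\<Sum>j\<in>UNIV. a j * w j))" using CK by simp
    have "(\<Sum>j\<in>UNIV. a j * v j) =
        C * K * (\<Sum>j\<in>UNIV. a j * w j) + C * sum a UNIV - (\<Sum>j\<in>UNIV. a j * \<phi> j)"
      by (simp add: v_def sum_distrib_left algebra_simps sum_subtractf sum.distrib)
    then have 2: "v i - (\<Sum>j\<in>UNIV. a j * v j) = C * K * (w i - (\<Sum>j\<in>UNIV. a j * w j))
        + C * (1 - sum a UNIV) + ((\<Sum>j\<in>UNIV. a j * \<phi> j) - \<phi> i)"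
      by (simp add: v_def algebra_simps)
    from rowL[OF L] show ?thesis
    proof
      assume "sum a UNIV \<le> 1 - \<rho>"
      then have "C * \<rho> \<le> C * (1 - sum a UNIV)" using C by (intro mult_left_mono) auto
      moreover have "0 \<le> (\<Sum>j\<in>UNIV. a j * \<phi> j)"
        using a \<phi>(1) \<rho> by (intro sum_nonneg mult_nonneg_nonneg) (auto intro: order_trans[of 0 \<rho>])
      ultimately show ?thesis using 1 2 C \<phi>(2)[of i] \<rho> by linarith
    next
      assume "2 * \<phi> i \<le> (\<Sum>j\<in>UNIV. a j * \<phi> j)"
      moreover have "0 \<le> C * (1 - sum a UNIV)" using C a by simp
      ultimately show ?thesis using 1 2 \<phi>(1)[of i] by linarith
    qed
  qed
  have vQ: "\<rho> / 2 \<le> v i - (y $ j + w j / 4) * v k - (y $ k + w k / 4) * v j"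
    if Q: "S i = FormQ j k" for i j k
  proof -
    define A where "A = y $ j + w j / 4"
    define B where "B = y $ k + w k / 4"
    have AB: "0 \<le> A" "A \<le> 1" "0 \<le> B" "B \<le> 1"
      using y[of j] y[of k] \<rho> by (auto simp: A_def B_def w_def field_simps)
    have "\<rho> * \<rho> \<le> w j * w k" using w[of j] w[of k] \<rho> by (intro mult_mono) auto
    then have "\<rho>\<^sup>2 \<le> w j * w k" by (simp add: power2_eq_square)
    moreover have "w i - A * w k - B * w j = w j * w k / 2 + (y $ j * y $ k - y $ i)"
      by (simp add: A_def B_def w_def field_simps)
    ultimately have "\<rho>\<^sup>2 / 2 - \<eta> \<le> w i - A * w k - B * w j" using e[of i] Q by simp
    then have "C * K * (\<rho>\<^sup>2 / 2 - \<eta>) \<le> C * K * (w i - A * w k - B * w j)"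
      using C K by (intro mult_left_mono) auto
    moreover have "C * K * (\<rho>\<^sup>2 / 2 - \<eta>) = C * (K * \<rho>\<^sup>2) / 2 - C * K * \<eta>"
      by (simp add: algebra_simps)
    ultimately have 1: "2 * C - \<rho> / 2 \<le> C * K * (w i - A * w k - B * w j)" using CK K by simp
    have 2: "C * (- 1) \<le> C * (1 - A - B)" using C AB by (intro mult_left_mono) auto
    have 3: "0 \<le> A * \<phi> k" "0 \<le> B * \<phi> j"
      using AB \<phi>(1)[of k] \<phi>(1)[of j] \<rho> by simp_all
    have "v i - A * v k - B * v j = C * K * (w i - A * w k - B * w j) + C * (1 - A - B)
        - \<phi> i + A * \<phi> k + B * \<phi> j"
      by (simp add: v_def algebra_simps)
    then show ?thesis using 1 2 3 C \<phi>(2)[of i] \<rho> unfolding A_def B_def by linarith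
  qed
  define t where "t = 2 * \<eta> / \<rho>"
  have t0: "0 \<le> t" and t\<eta>: "t * (\<rho> / 2) = \<eta>" using \<eta>0 \<rho> by (auto simp: t_def)
  define s where "s = (\<lambda>i. t * v i)"
  have s0: "0 \<le> s i" for i using t0 v0 by (simp add: s_def)
  have s1: "s i \<le> 20 * \<eta> / \<rho> ^ 4" for i
  proof -
    have "s i \<le> t * (10 / \<rho> ^ 3)" unfolding s_def using t0 v1 by (intro mult_left_mono)
    also have "\<dots> = 20 * \<eta> / \<rho> ^ 4" by (simp add: t_def power_numeral_reduce)
    finally show ?thesis .
  qed
  have sw: "s i \<le> w i / 2" for i
  proof -
    have "20 * \<eta> / \<rho> ^ 4 \<le> (\<rho> ^ 5 / 2) / \<rho> ^ 4" using \<eta> \<rho> by (intro divide_right_mono) auto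
    also have "\<dots> = \<rho> / 2" using \<rho> by (simp add: field_simps power_numeral_reduce)
    finally show ?thesis using s1[of i] w(1)[of i] by linarith
  qed
  define h where "h = (\<chi> i. y $ i + s i)"
  show ?thesis
  proof (rule that[of h])
    show "y $ i \<le> h $ i" "h $ i \<le> y $ i + 20 * \<eta> / \<rho> ^ 4" for i
      using s0 s1 by (auto simp: h_def)
    show "h $ i < 1" for i
      using sw[of i] w(1)[of i] \<rho> by (simp add: h_def w_def)
    show "eval_form (S i) h \<le> h $ i" for i
    proof (cases "S i")
      case (FormL a0 a)
      have "t * (\<rho> / 2) \<le> t * (v i - (\<Sum>j\<in>UNIV. a j * v j))"
        using vL[OF FormL] t0 by (intro mult_left_mono)
      also have "\<dots> = s i - (\<Sum>j\<in>UNIV. a j * s j)"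
        by (simp add: s_def right_diff_distrib sum_distrib_left mult.left_commute)
      finally show ?thesis using t\<eta> e[of i] FormL
        by (simp add: h_def algebra_simps sum.distrib)
    next
      case (FormQ j k)
      have "t * (\<rho> / 2) \<le> t * (v i - (y $ j + w j / 4) * v k - (y $ k + w k / 4) * v j)"
        using vQ[OF FormQ] t0 by (intro mult_left_mono)
      also have "\<dots> = s i - (y $ j + w j / 4) * s k - (y $ k + w k / 4) * s j"
        by (simp add: s_def algebra_simps)
      finally have 1: "\<eta> \<le> s i - (y $ j + w j / 4) * s k - (y $ k + w k / 4) * s j"
        using t\<eta> by simp
      have "s j * s k \<le> w j / 2 * s k" "s j * s k \<le> s j * (w k / 2)"
        by (rule mult_right_mono[OF sw s0], rule mult_left_mono[OF sw s0])
      then show ?thesis using 1 e[of i] FormQ by (simp add: h_def algebra_simps)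
    next
      case (FormM j k)
      then show ?thesis using noM by blast
    qed
  qed
qed


lemma substochastic_real_system:
  assumes "minPPS_SNF P"
  shows "substochastic (real_system P)"
  unfolding substochastic_def
proof (intro allI impI)
  fix i a0 a assume "real_system P i = FormL a0 a"
  then obtain b0 b where b: "P i = FormL b0 b" "a0 = real_of_rat b0" "a = (\<lambda>j. real_of_rat (b j))"
    by (cases "P i") (auto simp: real_system_def comp_def)
  then have 1: "0 \<le> b0" "\<And>j. 0 \<le> b j" "b0 + sum b UNIV \<le> 1"
    using assms by (auto simp: minPPS_SNF_def)
  have "real_of_rat (b0 + sum b UNIV) \<le> 1" using 1(3) by simp
  then show "0 \<le> a0 \<and> (\<forall>j. 0 \<le> a j) \<and> a0 + sum a UNIV \<le> 1"
    using 1 b by (simp add: of_rat_add of_rat_sum)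
qed

lemma policy_system_not_FormM: "policy_system P \<rho> i = FormM j k \<longleftrightarrow> False"
  by (cases "P i") (auto simp: policy_system_def)

lemma policy_system_eq_real_system:
  "(\<And>j k. P i \<noteq> FormM j k) \<Longrightarrow> policy_system P \<rho> i = real_system P i"
  by (cases "P i") (auto simp: policy_system_def real_system_def)

lemma pmf_True_False: "pmf p True + pmf p False = 1"
proof -
  have "sum (pmf p) UNIV = 1" by (rule sum_pmf_eq_1) auto
  then show ?thesis by (simp add: UNIV_bool)
qed

lemma policy_system_FormM:
  assumes "P i = FormM j k"
  shows "policy_system P \<rho> i = FormL 0 (\<lambda>l. pmf (\<rho> i) True * of_bool (l = j) + pmf (\<rho> i) False * of_bool (l = k))"
    "eval_form (policy_system P \<rho> i) x = pmf (\<rho> i) True * x $ j + pmf (\<rho> i) False * x $ k"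
proof -
  show 1: "policy_system P \<rho> i = FormL 0 (\<lambda>l. pmf (\<rho> i) True * of_bool (l = j) + pmf (\<rho> i) False * of_bool (l = k))"
    using assms by (simp add: policy_system_def)
  have s: "(\<Sum>l\<in>UNIV. c * of_bool (l = m) * x $ l) = c * x $ m" for c m
  proof -
    have "(\<Sum>l\<in>UNIV. c * of_bool (l = m) * x $ l) = (\<Sum>l\<in>UNIV. if l = m then c * x $ l else 0)"
      by (intro sum.cong) auto
    then show ?thesis by simp
  qed
  show "eval_form (policy_system P \<rho> i) x = pmf (\<rho> i) True * x $ j + pmf (\<rho> i) False * x $ k"
    by (simp add: 1 distrib_right sum.distrib s)
qed

lemma substochastic_policy_system:
  assumes "minPPS_SNF P"
  shows "substochastic (policy_system P \<rho>)"
  unfolding substochastic_def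
proof (intro allI impI)
  fix i a0 a assume L: "policy_system P \<rho> i = FormL a0 a"
  show "0 \<le> a0 \<and> (\<forall>j. 0 \<le> a j) \<and> a0 + sum a UNIV \<le> 1"
  proof (cases "\<exists>j k. P i = FormM j k")
    case True
    then obtain j k where P: "P i = FormM j k" by blast
    have "eval_form (policy_system P \<rho> i) 1 = 1"
      using policy_system_FormM(2)[of P i j k \<rho> 1, OF P] pmf_True_False[of "\<rho> i"] by simp
    then show ?thesis using L policy_system_FormM(1)[of P i j k \<rho>, OF P] by auto
  next
    case False
    then have "real_system P i = FormL a0 a" using L policy_system_eq_real_system[of P i \<rho>] by simp
    then show ?thesis using substochastic_real_system[OF assms] by (auto simp: substochastic_def)
  qed
qed

lemma pure_policy_FormM:
  assumes "P i = FormM j k"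
  shows "eval_form (policy_system P (pure_policy \<sigma>) i) x = x $ choice j k (\<sigma> i)"
    "occurs l (policy_system P (pure_policy \<sigma>) i) \<longleftrightarrow> l = choice j k (\<sigma> i)"
  using policy_system_FormM[of P i j k, OF assms]
  by (auto simp: pure_policy_def choice_def pmf_return indicator_def)

definition denom :: "rat \<Rightarrow> int" where
  "denom q = snd (quotient_of q)"

definition coeff_size :: "rat \<Rightarrow> nat" where
  "coeff_size q = (if q = 0 then 0 else rat_size q)"

lemma denom_pos: "0 < denom q"
  by (simp add: denom_def quotient_of_denom_pos')

lemma denom_mult_Ints: "of_int (denom q) * q \<in> \<int>"
proof -
  obtain a b where "quotient_of q = (a, b)" by fastforce
  then have "q = of_int a / of_int b" "b > 0" "denom q = b"
    using quotient_of_div quotient_of_denom_pos by (auto simp: denom_def)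
  then show ?thesis by simp
qed

lemma denom_le: "of_int (denom q) \<le> (2::real) ^ coeff_size q"
proof (cases "q = 0")
  case False
  have "nat (denom q) < 2 ^ floorlog 2 (nat (denom q))"
    using floorlog_bounds[of "nat (denom q)" 2] denom_pos[of q] by simp
  also have "\<dots> \<le> 2 ^ coeff_size q"
    using False by (intro power_increasing) (auto simp: coeff_size_def rat_size_def denom_def)
  finally have "real (nat (denom q)) \<le> real (2 ^ coeff_size q)" by (simp only: of_nat_le_iff)
  then show ?thesis using denom_pos[of q] by simp
qed (simp add: coeff_size_def denom_def)

lemma rat_lower_bound:
  fixes q :: rat
  assumes "0 < q" "of_int d * q \<in> \<int>" "0 < d" "of_int d \<le> (2::real) ^ m"
  shows "(1/2) ^ m \<le> real_of_rat q"
proof -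
  obtain n where n: "of_int d * q = of_int n" using assms(2) by (auto elim: Ints_cases)
  have "0 < of_int d * q" using assms by simp
  then have "0 < n" using n by simp
  then have "1 \<le> of_int d * q" using n by simp
  then have "real_of_rat 1 \<le> real_of_rat (of_int d * q)" by (simp only: of_rat_less_eq)
  then have "1 \<le> of_int d * real_of_rat q" by (simp add: of_rat_mult)
  also have "\<dots> \<le> 2 ^ m * real_of_rat q" using assms by (intro mult_right_mono) auto
  finally show ?thesis by (simp add: field_simps power_one_over)
qed

lemma form_size_FormL_ge:
  "2 + coeff_size a0 + (\<Sum>j\<in>UNIV. coeff_size (a j)) \<le> form_size (FormL a0 a)"
proof -
  have "(\<Sum>j\<in>UNIV. coeff_size (a j)) = (\<Sum>j | a j \<noteq> 0. coeff_size (a j))"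
    by (rule sum.mono_neutral_right) (auto simp: coeff_size_def)
  also have "\<dots> \<le> (\<Sum>j | a j \<noteq> 0. index_size TYPE('a) + rat_size (a j))"
    by (rule sum_mono) (simp add: coeff_size_def)
  finally show ?thesis by (simp add: coeff_size_def)
qed

lemma form_size_ge_2: "2 \<le> form_size f"
  by (cases f) auto

lemma half_power_antimono: "m \<le> n \<Longrightarrow> (1/2::real) ^ n \<le> (1/2) ^ m"
  by (intro power_decreasing) auto

lemma coeff_lower_bounds:
  fixes P :: "('n::finite, rat) system"
  assumes P: "minPPS_SNF P" "P i = FormL a0 a"
  shows "a j \<noteq> 0 \<Longrightarrow> (1/2) ^ form_size (P i) \<le> real_of_rat (a j) / 2"
    "a0 \<noteq> 0 \<Longrightarrow> (1/2) ^ form_size (P i) \<le> real_of_rat a0"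
    "a0 + sum a UNIV < 1 \<Longrightarrow> (1/2) ^ form_size (P i) \<le> 1 - real_of_rat (a0 + sum a UNIV)"
proof -
  have a: "0 \<le> a0" "\<And>j. 0 \<le> a j" "a0 + sum a UNIV \<le> 1" using P by (auto simp: minPPS_SNF_def)
  note fs = form_size_FormL_ge[of a0 a, folded P(2)]
  have lb: "(1/2) ^ coeff_size q \<le> real_of_rat q" if "0 < q" for q
    using that denom_mult_Ints denom_pos denom_le by (rule rat_lower_bound)
  show "(1/2) ^ form_size (P i) \<le> real_of_rat (a j) / 2" if "a j \<noteq> 0"
  proof -
    have "coeff_size (a j) \<le> (\<Sum>j\<in>UNIV. coeff_size (a j))" by (rule member_le_sum) auto
    then have "(1/2::real) ^ form_size (P i) \<le> (1/2) ^ Suc (coeff_size (a j))"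
      using fs by (intro half_power_antimono) linarith
    then show ?thesis using lb[of "a j"] a(2)[of j] that by simp
  qed
  show "(1/2) ^ form_size (P i) \<le> real_of_rat a0" if "a0 \<noteq> 0"
  proof -
    have "(1/2::real) ^ form_size (P i) \<le> (1/2) ^ coeff_size a0"
      using fs by (intro half_power_antimono) linarith
    then show ?thesis using lb[of a0] a(1) that by linarith
  qed
  assume lt: "a0 + sum a UNIV < 1"
  have prodI: "of_int (\<Prod>j\<in>J. denom (a j)) * sum a J \<in> \<int>" if "finite J" for J
    using that
  proof induction
    case (insert x J)
    have "of_int (\<Prod>j\<in>insert x J. denom (a j)) * sum a (insert x J) =
      of_int (\<Prod>j\<in>J. denom (a j)) * (of_int (denom (a x)) * a x) +
      of_int (denom (a x)) * (of_int (\<Prod>j\<in>J. denom (a j)) * sum a J)"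
      using insert by (simp add: algebra_simps)
    also have "\<dots> \<in> \<int>"
      by (rule Ints_add[OF Ints_mult[OF Ints_of_int denom_mult_Ints] Ints_mult[OF Ints_of_int insert.IH]])
    finally show ?case .
  qed simp
  let ?p = "\<Prod>j\<in>UNIV. denom (a j)"
  let ?m = "coeff_size a0 + (\<Sum>j\<in>UNIV. coeff_size (a j))"
  have "(1/2) ^ ?m \<le> real_of_rat (1 - (a0 + sum a UNIV))"
  proof (rule rat_lower_bound)
    have "of_int (denom a0 * ?p) * (1 - (a0 + sum a UNIV)) =
      of_int (denom a0 * ?p) - of_int ?p * (of_int (denom a0) * a0)
      - of_int (denom a0) * (of_int ?p * sum a UNIV)"
      by (simp add: algebra_simps)
    also have "\<dots> \<in> \<int>"

      by (rule Ints_diff[OF Ints_diff[OF Ints_of_int Ints_mult[OF Ints_of_int denom_mult_Ints]]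
          Ints_mult[OF Ints_of_int prodI[OF finite]]])
    finally show "of_int (denom a0 * ?p) * (1 - (a0 + sum a UNIV)) \<in> \<int>" .
    show "0 < denom a0 * ?p" using denom_pos by (auto intro!: mult_pos_pos prod_pos)
    have "real_of_int ?p = (\<Prod>j\<in>UNIV. real_of_int (denom (a j)))" by simp
    also have "\<dots> \<le> (\<Prod>j\<in>UNIV. 2 ^ coeff_size (a j))"
      using denom_le denom_pos by (intro prod_mono) (auto simp: less_imp_le)
    also have "\<dots> = 2 ^ (\<Sum>j\<in>UNIV. coeff_size (a j))" by (simp add: power_sum)
    finally have "real_of_int (denom a0) * real_of_int ?p
        \<le> 2 ^ coeff_size a0 * 2 ^ (\<Sum>j\<in>UNIV. coeff_size (a j))"
      using denom_le[of a0] denom_pos by (intro mult_mono) (auto intro!: prod_nonneg simp: less_imp_le)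
    then show "real_of_int (denom a0 * ?p) \<le> 2 ^ ?m" by (simp add: power_add)
  qed (use lt in simp)
  moreover have "(1/2::real) ^ form_size (P i) \<le> (1/2) ^ ?m"
    using fs by (intro half_power_antimono) linarith
  moreover have "real_of_rat (1 - (a0 + sum a UNIV)) = 1 - real_of_rat (a0 + sum a UNIV)"
    by (simp add: of_rat_diff)
  ultimately show "(1/2) ^ form_size (P i) \<le> 1 - real_of_rat (a0 + sum a UNIV)" by linarith
qed

lemma prod_half_power_form_size:
  "(\<Prod>i\<in>UNIV. (1/2::real) ^ form_size (P i)) = (1/2) ^ system_size P"
  by (simp add: system_size_def power_sum)

lemma real_system_FormL:
  assumes "real_system P i = FormL b0 b"
  obtains a0 a where "P i = FormL a0 a" "b0 = real_of_rat a0" "b = (\<lambda>j. real_of_rat (a j))"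
  using assms by (cases "P i") (auto simp: real_system_def comp_def)

lemma real_system_coeff_lower_bounds:
  fixes P :: "('n::finite, rat) system"
  assumes P: "minPPS_SNF P" "real_system P i = FormL b0 b"
  shows "b j \<noteq> 0 \<Longrightarrow> (1/2) ^ form_size (P i) \<le> b j / 2"
    "b0 \<noteq> 0 \<Longrightarrow> (1/2) ^ form_size (P i) \<le> b0"
    "b0 + sum b UNIV < 1 \<Longrightarrow> (1/2) ^ form_size (P i) \<le> 1 - (b0 + sum b UNIV)"
proof -
  obtain a0 a where a: "P i = FormL a0 a" "b0 = real_of_rat a0" "b = (\<lambda>j. real_of_rat (a j))"
    using P(2) by (rule real_system_FormL)
  have s: "b0 + sum b UNIV = real_of_rat (a0 + sum a UNIV)"
    using a by (simp add: of_rat_add of_rat_sum)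
  show "b j \<noteq> 0 \<Longrightarrow> (1/2) ^ form_size (P i) \<le> b j / 2"
    "b0 \<noteq> 0 \<Longrightarrow> (1/2) ^ form_size (P i) \<le> b0"
    "b0 + sum b UNIV < 1 \<Longrightarrow> (1/2) ^ form_size (P i) \<le> 1 - (b0 + sum b UNIV)"
    using coeff_lower_bounds[OF P(1) a(1)] a s by auto
qed

lemma one_minus_gfix_ge:
  fixes P :: "('n::finite, rat) system"
  assumes P: "minPPS_SNF P" and lt: "\<And>i. gfix (real_system P) $ i < 1"
  shows "(1/2) ^ system_size P \<le> 1 - gfix (real_system P) $ i"
proof -
  let ?S = "real_system P" let ?g = "gfix ?S"
  let ?c = "\<lambda>i. (1/2::real) ^ form_size (P i)"
  have S: "substochastic ?S" by (rule substochastic_real_system[OF P])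
  note g = gfix_bounds[OF S]
  note ge = one_minus_fixpoint_ge[OF S, of ?g, OF g]
  have "prod ?c UNIV \<le> 1 - ?g $ i"
  proof (rule reach_lower_bound[where T = "{l. eval_form (?S l) 1 < 1}" and E = "dep_graph ?S"])
    show "\<exists>l\<in>{l. eval_form (?S l) 1 < 1}. (i, l) \<in> (dep_graph ?S)\<^sup>*" for i
      using reaches_leak[OF S lt, of i] by blast
    show "?c i \<le> 1 - ?g $ i" if "i \<in> {l. eval_form (?S l) 1 < 1}" for i
    proof (cases "?S i")
      case (FormL b0 b)
      have "?c i \<le> 1 - eval_form (?S i) 1"
        using real_system_coeff_lower_bounds(3)[OF P FormL] that FormL by simp
      then show ?thesis using ge(1)[of i] by linarith
    qed (use that in auto)
    show "?c i * (1 - ?g $ b) \<le> 1 - ?g $ i" if "(i, b) \<in> dep_graph ?S" for i b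
    proof (cases "?S i")
      case (FormL b0 a)
      then have nz: "a b \<noteq> 0" using that by (simp add: dep_graph_def)
      have "0 \<le> a b" using S FormL by (auto simp: substochastic_def)
      then have "?c i \<le> a b" using real_system_coeff_lower_bounds(1)[OF P FormL nz] by linarith
      then have "?c i * (1 - ?g $ b) \<le> a b * (1 - ?g $ b)"
        using g(2)[of b] by (intro mult_right_mono) auto
      then show ?thesis using ge(2)[OF FormL, of b] by linarith
    next
      case (FormQ j k)
      have "?c i * (1 - ?g $ b) \<le> 1 * (1 - ?g $ b)"
        using g(2)[of b] by (intro mult_right_mono power_le_one) auto
      then show ?thesis using ge(3)[of b i] that FormQ by (simp add: dep_graph_def)
    next
      case (FormM j k)
      have "?c i * (1 - ?g $ b) \<le> 1 * (1 - ?g $ b)"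
        using g(2)[of b] by (intro mult_right_mono power_le_one) auto
      then show ?thesis using ge(3)[of b i] that FormM by (simp add: dep_graph_def)
    qed
  qed (auto intro: power_le_one)
  then show ?thesis by (simp add: prod_half_power_form_size)
qed

lemma eval_form_near_fixpoint:
  assumes S: "substochastic S" and y: "\<And>i. 0 \<le> y $ i" "\<And>i. y $ i \<le> g $ i"
    and g: "\<And>i. g $ i \<le> 1" "\<And>i. g $ i \<le> y $ i + \<delta>" and fp: "\<And>i. eval_form (S i) g = g $ i"
  shows "\<bar>eval_form (S i) y - y $ i\<bar> \<le> 2 * \<delta>"
proof -
  have \<delta>: "0 \<le> \<delta>" using y(2)[of i] g(2)[of i] by linarith
  have up: "eval_form (S i) y \<le> g $ i" using eval_form_mono[OF S y, of i] fp by simp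
  have "eval_form (S i) g \<le> eval_form (S i) y + 2 * \<delta>"
  proof (cases "S i")
    case (FormL a0 a)
    then have a: "\<And>j. 0 \<le> a j" "0 \<le> a0" "a0 + sum a UNIV \<le> 1" using S by (auto simp: substochastic_def)
    have "(\<Sum>j\<in>UNIV. a j * g $ j) \<le> (\<Sum>j\<in>UNIV. a j * (y $ j + \<delta>))"
      using a g by (intro sum_mono mult_left_mono) auto
    also have "\<dots> = (\<Sum>j\<in>UNIV. a j * y $ j) + sum a UNIV * \<delta>"
      by (simp add: algebra_simps sum.distrib sum_distrib_left)
    also have "sum a UNIV * \<delta> \<le> 1 * \<delta>" using a \<delta> by (intro mult_right_mono) auto
    finally show ?thesis using FormL \<delta> by simp
  next
    case (FormQ j k)
    have "g $ j * g $ k - y $ j * y $ k = g $ j * (g $ k - y $ k) + (g $ j - y $ j) * y $ k"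
      by (simp add: algebra_simps)
    also have "\<dots> \<le> 1 * \<delta> + \<delta> * 1"
      using y[of k] y[of j] g(1)[of j] g(1)[of k] g(2)[of j] g(2)[of k]
      by (intro add_mono mult_mono) auto
    finally show ?thesis using FormQ by simp
  next
    case (FormM j k)
    then show ?thesis using g(2)[of j] g(2)[of k] \<delta> by auto
  qed
  then show ?thesis using up fp[of i] y(2)[of i] g(2)[of i] \<delta> by linarith
qed

lemma policy1_visits_residual:
  assumes "policy1_visits P \<epsilon> y \<sigma>"
    and R: "\<And>i. \<bar>eval_form (real_system P i) y - y $ i\<bar> \<le> 2 powr (- 14 * real (system_size P) - 2) * \<epsilon>"
  shows "\<bar>eval_form (policy_system P (pure_policy \<sigma>) i) y - y $ i\<bar>
    \<le> 2 powr (- 14 * real (system_size P) - 2) * \<epsilon>"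
  using assms(1)
proof (induction arbitrary: i)
  case (init \<sigma>)
  then have "eval_form (policy_system P (pure_policy \<sigma>) i) y = eval_form (real_system P i) y"
    by (metis eval_system_nth)
  then show ?case using R by simp
next
  case (switch \<sigma> i' j k b)
  show ?case
  proof (cases "i = i'")
    case True
    have "eval_form (policy_system P (pure_policy (\<sigma>(i' := b))) i) y = y $ choice j k b"
      using pure_policy_FormM(1)[of P i' j k "\<sigma>(i' := b)" y, OF switch.hyps(3)] True
      by (simp only: fun_upd_same)
    then show ?thesis using switch.hyps(6) True by (simp only: abs_minus_commute)
  next
    case False
    then have "policy_system P (pure_policy (\<sigma>(i' := b))) i = policy_system P (pure_policy \<sigma>) i"
      by (simp add: policy_system_def pure_policy_def)
    then show ?thesis using switch.IH[of i] by (simp only:)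
  qed
qed


lemma infnorm_cart_le:
  fixes x :: "real ^ 'n"
  assumes "\<And>i. \<bar>x $ i\<bar> \<le> c"
  shows "infnorm x \<le> c"
  unfolding infnorm_cart using assms by (intro cSup_least) auto

lemma powr_encoding_size:
  "2 powr (- real m * real n - real k) = ((1/2) ^ n) ^ m / 2 ^ k"
proof -
  have "- real m * real n - real k = - real (n * m) - real k" by simp
  then have "2 powr (- real m * real n - real k) = 2 powr (- real (n * m)) / 2 powr (real k)"
    by (simp only: powr_diff)
  also have "\<dots> = ((1/2) ^ n) ^ m / 2 ^ k"
    by (simp only: powr_minus powr_realpow power_mult) (simp add: power_one_over inverse_eq_divide)
  finally show ?thesis .
qed

lemma gfix_real_le_gfix_policy:
  assumes P: "minPPS_SNF P"
  shows "gfix (real_system P) $ i \<le> gfix (policy_system P \<rho>) $ i"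
proof -
  let ?g = "gfix (real_system P)"
  have R: "substochastic (real_system P)" by (rule substochastic_real_system[OF P])
  have S: "substochastic (policy_system P \<rho>)" by (rule substochastic_policy_system[OF P])
  have "?g $ k \<le> eval_form (policy_system P \<rho> k) ?g" for k
  proof (cases "\<exists>j l. P k = FormM j l")
    case True
    then obtain j l where M: "P k = FormM j l" by blast
    then have g: "?g $ k = min (?g $ j) (?g $ l)"
      using gfix_bounds(3)[OF R, of k] by (simp add: real_system_def)
    have "?g $ k = pmf (\<rho> k) True * ?g $ k + pmf (\<rho> k) False * ?g $ k"
      using pmf_True_False[of "\<rho> k"] by (simp flip: distrib_right)
    also have "\<dots> \<le> pmf (\<rho> k) True * ?g $ j + pmf (\<rho> k) False * ?g $ l"
      using g by (intro add_mono mult_left_mono) auto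
    finally show ?thesis using policy_system_FormM(2)[of P k j l \<rho>, OF M] by simp
  next
    case False
    then show ?thesis
      using policy_system_eq_real_system[of P k \<rho>] gfix_bounds(3)[OF R, of k] by simp
  qed
  then have "?g \<le> gfix (policy_system P \<rho>)"
    using gfix_greatest(1)[OF R] by (intro gfix_greatest(3)[OF S]) (auto simp: less_eq_vec_def)
  then show ?thesis by (simp add: less_eq_vec_def)
qed

lemma gfix_policy_less_one_mono:
  fixes P :: "('n::finite, rat) system"
  assumes P: "minPPS_SNF P" and lt: "\<And>i. gfix (policy_system P (pure_policy \<tau>)) $ i < 1"
    and pos: "\<And>i j k. P i = FormM j k \<Longrightarrow> 0 < pmf (\<upsilon> i) (\<tau> i)"
  shows "gfix (policy_system P \<upsilon>) $ i < 1"
proof -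
  let ?S = "policy_system P \<upsilon>" let ?T = "policy_system P (pure_policy \<tau>)"
  have S: "substochastic ?S" and T: "substochastic ?T"
    using substochastic_policy_system[OF P] by blast+
  note ge = one_minus_fixpoint_ge[OF S, of "gfix ?S", OF gfix_bounds[OF S]]
  have same: "?S i = ?T i" if "\<And>j k. P i \<noteq> FormM j k" for i
    using policy_system_eq_real_system[of P i] that by simp
  have step: "gfix ?S $ i < 1" if "(i, l) \<in> dep_graph ?T" "gfix ?S $ l < 1" for i l
  proof -
    have occ: "occurs l (?T i)" using that by (simp add: dep_graph_def)
    have "\<exists>c>0. c * (1 - gfix ?S $ l) \<le> 1 - gfix ?S $ i"
    proof (cases "\<exists>j k. P i = FormM j k")
      case True
      then obtain j k where M: "P i = FormM j k" by blast
      have l: "l = choice j k (\<tau> i)" using pure_policy_FormM(2)[of P i j k l \<tau>, OF M] occ by simp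
      let ?a = "\<lambda>l. pmf (\<upsilon> i) True * of_bool (l = j) + pmf (\<upsilon> i) False * of_bool (l = k)"
      have "pmf (\<upsilon> i) (\<tau> i) \<le> ?a l" using l by (cases "\<tau> i") (auto simp: choice_def)
      then have "0 < ?a l" using pos[OF M] by linarith
      then show ?thesis using ge(2)[OF policy_system_FormM(1)[of P i j k \<upsilon>, OF M], of l] by blast
    next
      case False
      then have eq: "?S i = ?T i" using same by blast
      show ?thesis
      proof (cases "?S i")
        case (FormL a0 a)
        then have "a l \<noteq> 0" "0 \<le> a l" using occ eq S by (auto simp: substochastic_def)
        then show ?thesis using ge(2)[OF FormL, of l] by (intro exI[of _ "a l"]) auto
      next
        case (FormQ j k)
        then show ?thesis using ge(3)[of l i] occ eq by (intro exI[of _ 1]) auto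
      qed (simp add: policy_system_not_FormM)
    qed
    then show ?thesis using that(2) by (smt (verit) mult_pos_pos)
  qed
  obtain l where l: "(i, l) \<in> (dep_graph ?T)\<^sup>*" "eval_form (?T l) 1 < 1"
    using reaches_leak[OF T lt] by blast
  have "P l \<noteq> FormM j k" for j k
    using l(2) pure_policy_FormM(1)[of P l j k \<tau> 1] by auto
  then have "gfix ?S $ l < 1" using same[of l] l(2) ge(1)[of l] by simp
  with l(1) show ?thesis by (induction rule: converse_rtrancl_induct) (auto intro: step)
qed

theorem theorem8p8:
  fixes P :: "('n::finite, rat) system" and \<epsilon> :: real
    and \<sigma> \<tau> :: "'n det_policy" and \<upsilon> :: "'n policy"
  assumes "minPPS_SNF P"
    and "\<forall>i. gfix (real_system P) $ i < 1"
    and "\<epsilon> > 0"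
    and "policy1_output P \<epsilon> \<sigma>"
    and "\<forall>i. gfix (policy_system P (pure_policy \<tau>)) $ i < 1"
    and "\<forall>i j k b. P i = FormM j k \<longrightarrow>
      pmf (\<upsilon> i) b =
        2 powr (- 28 * real (system_size P) - 4) * \<epsilon> * of_bool (b = \<tau> i) +
        (1 - 2 powr (- 28 * real (system_size P) - 4) * \<epsilon>) * of_bool (b = \<sigma> i)"
  shows "infnorm (gfix (real_system P) - gfix (policy_system P \<upsilon>)) \<le> \<epsilon>"
proof -
  define \<rho> :: real where "\<rho> = (1/2) ^ system_size P"
  define p where "p = \<rho> ^ 28 / 16 * \<epsilon>"
  define g where "g = gfix (real_system P)"
  let ?R = "real_system P" and ?S = "policy_system P \<upsilon>" and ?U = "policy_system P (pure_policy \<sigma>)"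
  have P: "minPPS_SNF P" by fact
  have R: "substochastic ?R" by (rule substochastic_real_system[OF P])
  have S: "substochastic ?S" by (rule substochastic_policy_system[OF P])
  have mono: "g $ i \<le> gfix ?S $ i" for i unfolding g_def by (rule gfix_real_le_gfix_policy[OF P])
  show ?thesis
  proof (cases "\<epsilon> < 1")
    case False
    show ?thesis
    proof (rule infnorm_cart_le)
      show "\<bar>(gfix ?R - gfix ?S) $ i\<bar> \<le> \<epsilon>" for i
        using gfix_bounds(1,2)[OF R, of i] gfix_bounds(1,2)[OF S, of i] False by simp
    qed
  next
    case True
    have size: "form_size (P i) \<le> system_size P" for i
      unfolding system_size_def by (rule member_le_sum) auto
    then have "2 \<le> system_size P" using form_size_ge_2 order_trans by blast
    then have \<rho>4: "\<rho> \<le> 1 / 4"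
      unfolding \<rho>_def using half_power_antimono[of 2 "system_size P"] by (simp add: power2_eq_square)
    have \<rho>0: "0 < \<rho>" by (simp add: \<rho>_def)
    have c\<rho>: "\<rho> \<le> (1/2) ^ form_size (P i)" for i
      unfolding \<rho>_def by (rule half_power_antimono[OF size])
    have \<rho>_power: "\<rho> ^ n \<le> (1/4) ^ n" for n using \<rho>0 \<rho>4 by (intro power_mono) auto
    have pw: "2 powr (- 28 * real (system_size P) - 4) = \<rho> ^ 28 / 16"
      "2 powr (- 14 * real (system_size P) - 3) = \<rho> ^ 14 / 8"
      "2 powr (- 14 * real (system_size P) - 2) = \<rho> ^ 14 / 4"
      using powr_encoding_size[of 28 "system_size P" 4] powr_encoding_size[of 14 "system_size P" 3]
        powr_encoding_size[of 14 "system_size P" 2] by (simp_all add: \<rho>_def)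
    have pmf\<upsilon>: "pmf (\<upsilon> i) b = p * of_bool (b = \<tau> i) + (1 - p) * of_bool (b = \<sigma> i)"
      if "P i = FormM j k" for i j k b
      using assms(6) that unfolding pw p_def by blast
    have p0: "0 < p" using \<rho>0 assms(3) by (simp add: p_def)
    have "\<rho> ^ 28 \<le> \<rho> ^ 14" using \<rho>0 \<rho>4 by (intro power_decreasing) auto
    then have "\<rho> ^ 28 / 16 \<le> \<rho> ^ 14 / 8" using \<rho>0 zero_less_power[of \<rho> 14] by linarith
    then have p\<delta>: "p \<le> \<rho> ^ 14 / 8 * \<epsilon>"
      unfolding p_def using assms(3) by (intro mult_right_mono) auto
    have "\<rho> ^ 14 \<le> 1" using \<rho>0 \<rho>4 by (intro power_le_one) auto
    then have "\<rho> ^ 14 / 8 * \<epsilon> \<le> 1 / 8 * 1"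
      using True assms(3) by (intro mult_mono) auto
    then have p1: "p \<le> 1/2" using p\<delta> by linarith

    obtain y where y: "0 \<le> y" "y \<le> g" "infnorm (g - y) \<le> \<rho> ^ 14 / 8 * \<epsilon>"
      "policy1_visits P \<epsilon> y \<sigma>" "D_set ?U = {}"
      using assms(4) unfolding policy1_output_def pw g_def by blast
    have y0: "0 \<le> y $ i" and yg: "y $ i \<le> g $ i" for i
      using y(1,2) by (auto simp: less_eq_vec_def)
    have gy: "g $ i \<le> y $ i + \<rho> ^ 14 / 8 * \<epsilon>" for i
      using component_le_infnorm_cart[of "g - y" i] y(3) by simp
    have g\<rho>: "\<rho> \<le> 1 - g $ i" for i
      unfolding \<rho>_def g_def using assms(2) by (intro one_minus_gfix_ge[OF P]) auto
    have y1: "y $ i \<le> 1 - \<rho>" for i using g\<rho>[of i] yg[of i] by linarith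
    have near: "\<bar>eval_form (?R i) y - y $ i\<bar> \<le> 2 * (\<rho> ^ 14 / 8 * \<epsilon>)" for i
      using R y0 yg _ gy
    proof (rule eval_form_near_fixpoint)
      show "g $ i \<le> 1" "eval_form (?R i) g = g $ i" for i
        unfolding g_def using gfix_bounds[OF R] by auto
    qed
    have "\<bar>eval_form (?R i) y - y $ i\<bar> \<le> \<rho> ^ 14 / 4 * \<epsilon>" for i using near[of i] by linarith
    then have resU: "\<bar>eval_form (?U i) y - y $ i\<bar> \<le> \<rho> ^ 14 / 4 * \<epsilon>" for i
      using policy1_visits_residual[OF y(4), of i] unfolding pw by blast

    have same: "?S i = ?R i" "?U i = ?R i" if "\<And>j k. P i \<noteq> FormM j k" for i
      using policy_system_eq_real_system[of P i] that by auto
    define \<eta> where "\<eta> = 3 * \<rho> ^ 14 / 8 * \<epsilon>"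
    have resS: "\<bar>eval_form (?S i) y - y $ i\<bar> \<le> \<eta>" for i
    proof -
      have "\<bar>eval_form (?S i) y - eval_form (?U i) y\<bar> \<le> p"
      proof (cases "\<exists>j k. P i = FormM j k")
        case M: True
        then obtain j k where M: "P i = FormM j k" by blast
        let ?s = "y $ choice j k (\<sigma> i)" and ?t = "y $ choice j k (\<tau> i)"
        have "eval_form (?S i) y = p * ?t + (1 - p) * ?s"
          unfolding policy_system_FormM(2)[of P i j k \<upsilon>, OF M] pmf\<upsilon>[OF M] choice_def
          by (cases "\<sigma> i"; cases "\<tau> i") (simp_all add: algebra_simps)
        then have "eval_form (?S i) y - eval_form (?U i) y = p * (?t - ?s)"
          unfolding pure_policy_FormM(1)[of P i j k \<sigma>, OF M] by (simp add: algebra_simps)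
        moreover have "\<bar>?t - ?s\<bar> \<le> 1"
          using y0[of "choice j k (\<sigma> i)"] y0[of "choice j k (\<tau> i)"] \<rho>0
            y1[of "choice j k (\<sigma> i)"] y1[of "choice j k (\<tau> i)"] by linarith
        ultimately show ?thesis using p0 by (simp add: abs_mult mult_left_le)
      next
        case False
        then show ?thesis using same[of i] p0 by simp
      qed
      then show ?thesis using resU[of i] p\<delta> unfolding \<eta>_def by linarith
    qed

    define T where "T = {l. is_formQ (?U l) \<or> eval_system ?U 1 $ l < 1 \<or> eval_system ?U 0 $ l > 0}"
    have "F_set ?U = UNIV" using y(5) by (auto simp: D_set_def)
    then have reach: "\<exists>l\<in>T. (i, l) \<in> (dep_graph ?U)\<^sup>*" for i
      unfolding F_set_def T_def by blast
    obtain \<phi> :: "'n \<Rightarrow> real" where \<phi>: "\<And>i. (\<Prod>i\<in>UNIV. (1/2) ^ form_size (P i)) \<le> \<phi> i" "\<And>i. \<phi> i \<le> 1"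
      "\<And>i. i \<notin> T \<Longrightarrow> \<exists>b. (i, b) \<in> dep_graph ?U \<and> \<phi> i = (1/2) ^ form_size (P i) * \<phi> b"
      by (rule reach_potential[where c = "\<lambda>i. (1/2) ^ form_size (P i)", OF reach])
        (auto simp: power_le_one)
    have \<phi>\<rho>: "\<rho> \<le> \<phi> i" for i using \<phi>(1) by (simp add: prod_half_power_form_size \<rho>_def)
    have rowL: "sum a UNIV \<le> 1 - \<rho> \<or> 2 * \<phi> i \<le> (\<Sum>j\<in>UNIV. a j * \<phi> j)"
      if L: "?S i = FormL a0 a" for i a0 a
    proof -
      have a: "\<And>j. 0 \<le> a j" "0 \<le> a0" "a0 + sum a UNIV \<le> 1"
        using S L by (auto simp: substochastic_def)
      show ?thesis
      proof (cases "i \<in> T")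
        case iT: True
        have "P i \<noteq> FormM j k" for j k
        proof
          assume M: "P i = FormM j k"
          have "\<not> is_formQ (?U i)"
            using policy_system_FormM(1)[of P i j k "pure_policy \<sigma>", OF M] by simp
          then show False
            using iT pure_policy_FormM(1)[of P i j k \<sigma>, OF M] by (simp add: T_def)
        qed
        then have RL: "?R i = FormL a0 a" "?U i = FormL a0 a" using same[of i] L by auto
        have "a0 + sum a UNIV < 1 \<or> a0 \<noteq> 0" using iT RL by (auto simp: T_def)
        then show ?thesis
          using real_system_coeff_lower_bounds(2,3)[OF P RL(1)] c\<rho>[of i] a by linarith
      next
        case False
        then obtain b where b: "occurs b (?U i)" "\<phi> i = (1/2) ^ form_size (P i) * \<phi> b"
          using \<phi>(3) by (auto simp: dep_graph_def)
        have "2 * (1/2) ^ form_size (P i) \<le> a b"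
        proof (cases "\<exists>j k. P i = FormM j k")
          case M: True
          then obtain j k where M: "P i = FormM j k" by blast
          have bs: "b = choice j k (\<sigma> i)"
            using pure_policy_FormM(2)[of P i j k b \<sigma>, OF M] b(1) by simp
          have "a b = pmf (\<upsilon> i) True * of_bool (b = j) + pmf (\<upsilon> i) False * of_bool (b = k)"
            using L policy_system_FormM(1)[of P i j k \<upsilon>, OF M] by auto
          then have "pmf (\<upsilon> i) (\<sigma> i) \<le> a b" using bs by (cases "\<sigma> i") (auto simp: choice_def)
          moreover have "1 - p \<le> pmf (\<upsilon> i) (\<sigma> i)" using pmf\<upsilon>[OF M, of "\<sigma> i"] p0 by simp
          moreover have "(1/2::real) ^ form_size (P i) \<le> (1/2) ^ 2"
            by (rule half_power_antimono[OF form_size_ge_2])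
          ultimately show ?thesis using p1 by (simp add: power2_eq_square)
        next
          case False
          then have RL: "?R i = FormL a0 a" "?U i = FormL a0 a" using same[of i] L by auto
          then show ?thesis using real_system_coeff_lower_bounds(1)[OF P RL(1), of b] b(1) by simp
        qed
        then have "2 * (1/2) ^ form_size (P i) * \<phi> b \<le> a b * \<phi> b"
          using \<phi>\<rho>[of b] \<rho>0 by (intro mult_right_mono) auto
        also have "\<dots> \<le> (\<Sum>j\<in>UNIV. a j * \<phi> j)"
          using mult_nonneg_nonneg[OF a(1) order_trans[OF less_imp_le[OF \<rho>0] \<phi>\<rho>]]
          by (intro member_le_sum) auto
        finally show ?thesis using b(2) by simp
      qed
    qed

    have "15 * \<rho> ^ 9 \<le> 1" using \<rho>_power[of 9] by (simp add: power_divide)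
    then have "15 * \<rho> ^ 9 * \<epsilon> \<le> 1 * 1"
      using \<rho>0 True assms(3) by (intro mult_mono) auto
    then have "\<rho> ^ 5 * (15 * \<rho> ^ 9 * \<epsilon>) \<le> \<rho> ^ 5 * 1" using \<rho>0 by (intro mult_left_mono) auto
    moreover have "40 * \<eta> = \<rho> ^ 5 * (15 * \<rho> ^ 9 * \<epsilon>)"
      by (simp add: \<eta>_def flip: power_add)
    ultimately have \<eta>: "40 * \<eta> \<le> \<rho> ^ 5" by linarith
    obtain h where h: "\<And>i. y $ i \<le> h $ i" "\<And>i. h $ i < 1" "\<And>i. eval_form (?S i) h \<le> h $ i"
      "\<And>i. h $ i \<le> y $ i + 20 * \<eta> / \<rho> ^ 4"
    proof (rule prefixpoint_near[OF S _ \<rho>0 _ y0 y1 resS \<eta> \<phi>\<rho> \<phi>(2) rowL])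
      show "\<rho> \<le> 1" using \<rho>4 by simp
    qed (auto simp: policy_system_not_FormM)
    have lt: "gfix ?S $ i < 1" for i
    proof (rule gfix_policy_less_one_mono[OF P])
      show "gfix (policy_system P (pure_policy \<tau>)) $ i < 1" for i using assms(5) by blast
      show "0 < pmf (\<upsilon> i) (\<tau> i)" if "P i = FormM j k" for i j k
        using pmf\<upsilon>[OF that, of "\<tau> i"] p0 p1 by simp
    qed
    have up: "gfix ?S $ i \<le> h $ i" for i
    proof (rule gfix_le_prefixpoint[OF S _ lt _ h(2,3)])
      show "0 \<le> h $ i" for i using h(1)[of i] y0[of i] by linarith
    qed (simp add: policy_system_not_FormM)
    have "20 * \<eta> / \<rho> ^ 4 = 15/2 * \<rho> ^ 10 * \<epsilon>"
      using \<rho>0 by (simp add: \<eta>_def field_simps flip: power_add)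
    moreover have "15/2 * \<rho> ^ 10 \<le> 1" using \<rho>_power[of 10] by (simp add: power_divide)
    then have "15/2 * \<rho> ^ 10 * \<epsilon> \<le> 1 * \<epsilon>" using assms(3) by (intro mult_right_mono) auto
    ultimately have fin: "20 * \<eta> / \<rho> ^ 4 \<le> \<epsilon>" by simp
    show ?thesis
    proof (rule infnorm_cart_le)
      fix i
      have "gfix ?S $ i \<le> g $ i + \<epsilon>" using up[of i] h(4)[of i] yg[of i] fin by linarith
      then show "\<bar>(gfix ?R - gfix ?S) $ i\<bar> \<le> \<epsilon>"
        using mono[of i] by (simp add: g_def)
    qed
  qed
qed

end
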